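(* Let $\mathfrak c$ be a $\mathcal W$-graded category and let $\mathcal S$ be a thin ideal in $\mathcal W$. Let $\varphi_{\mathcal V}:\mathcal V\subseteq\mathcal W$ be the full subcategory of objects $W$ for which there exists a path $W\to W_1\to\cdots\to W_n\to W_{n+1}$ in $\mathcal W$ whose last map belongs to $\mathcal S$, and let $\varphi_{\mathcal U}:\mathcal U\subseteq\mathcal W$ be the full subcategory of objects $W$ for which there exists a path $W_1\to W_2\to\cdots\to W$ whose first map $W_1\to W_2$ belongs to $\mathcal S$. Put $\mathfrak a=\mathfrak c^{\varphi_{\mathcal U}}$, $\mathfrak b=\mathfrak c^{\varphi_{\mathcal V}}$, let $S$ be the restriction of $\mathcal S$ to a $\mathcal U$-$\mathcal V$-bifunctor and $M$ the restriction of $1_{\mathfrak c}$ to an $\mathfrak a$-$S$-$\mathfrak b$-bimodule. For $U\in\mathcal U$ and $V\in\mathcal V$, we have $\mathcal W(U,V)=\varnothing$. In particular, the categories $\mathcal U$ and $\mathcal V$ are disjoint, and there is an injection $\varphi:(\mathcal V\to_S\mathcal U)\to\mathcal W$ for which $(\mathfrak b\to_M\mathfrak a)=\mathfrak c^\varphi$. The following are equivalent: (1) $\varphi$ is an isomorphism; (2) we have $\mathrm{Ob}(\mathcal W)=\mathrm{Ob}(\mathcal V)\cup\mathrm{Ob}(\mathcal U)$ and $\mathcal S(V,U)=\mathcal W(V,U)$ for $V\in\mathcal V$ and $U\in\mathcal U$. In this case, we have $(\mathfrak b\to_M\mathfrak a)=\mathfrak c$.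
   Context: Fix a commutative ring $k$. For a small category $\mathcal W$, a ($k$-linear) $\mathcal W$-graded category $\mathfrak c$ consists of a set $\mathfrak c_W$ for each object $W$; a $k$-module $\mathfrak c_w(C,C')$ for each $w:W\to W'$, $C\in\mathfrak c_W$, $C'\in\mathfrak c_{W'}$; compositions $\mathfrak c_{w'}(C',C'')\otimes_k\mathfrak c_w(C,C')\to\mathfrak c_{w'w}(C,C'')$ and identities $1_C\in\mathfrak c_{1_W}(C,C)$, associative and unital. For a functor $\varphi:\mathcal X\to\mathcal W$, $\mathfrak c^\varphi$ is the $\mathcal X$-graded category with $\mathfrak c^\varphi_X=\mathfrak c_{\varphi(X)}$, $\mathfrak c^\varphi_x(C,C')=\mathfrak c_{\varphi(x)}(C,C')$. $\mathcal W(V,U)$ denotes morphisms $V\to U$. An ideal $\mathcal S$ in $\mathcal W$ consists of subsets $\mathcal S(V,U)\subseteq\mathcal W(V,U)$ closed under composition on either side with arbitrary morphisms of $\mathcal W$. It is thin if it contains no consecutive morphisms: if $z\in\mathcal S(V,U)$, $u'\in\mathcal W(V',V)$, $u\in\mathcal W(U,U')$, then $u'\notin\mathcal S$ and $u\notin\mathcal S$. A $\mathcal U$-$\mathcal V$-bifunctor is a functor $S:\mathcal V^{op}\times\mathcal U\to\mathsf{Set}$; here $S(V,U)=\mathcal S(V,U)$. An $\mathfrak a$-$S$-$\mathfrak b$-bimodule consists of $k$-modules $M_s(B,A)$ ($s\in S(V,U)$, $B\in\mathfrak b_V$, $A\in\mathfrak a_U$) with associative unital actions of $\mathfrak a$ on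 the left and $\mathfrak b$ on the right; here $M_s(B,A)=\mathfrak c_s(B,A)$. Arrow categories: $\mathcal V\to_S\mathcal U$ has objects $\mathrm{Ob}(\mathcal V)\sqcup\mathrm{Ob}(\mathcal U)$, morphisms within $\mathcal V$ and within $\mathcal U$ as given, morphisms $V\to U$ given by $S(V,U)$ and no morphisms $U\to V$. $\mathfrak b\to_M\mathfrak a$ is the $(\mathcal V\to_S\mathcal U)$-graded category with object sets and morphism modules those of $\mathfrak b$ over $\mathcal V$, those of $\mathfrak a$ over $\mathcal U$, and $M_s(B,A)$ over $s\in S(V,U)$; compositions are those of $\mathfrak a,\mathfrak b$ and the actions on $M$. "Injection" means a functor injective on objects and morphisms. *)

theory Defs
  imports "HOL-Algebra.Module"
begin

section \<open>Small categories and functors\<close>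

record ('o, 'm) cat =
  Obj :: "'o set"
  Arr :: "'m set"
  Dom :: "'m \<Rightarrow> 'o"
  Cod :: "'m \<Rightarrow> 'o"
  Ident :: "'o \<Rightarrow> 'm"
  Cmp :: "'m \<Rightarrow> 'm \<Rightarrow> 'm"  \<comment> \<open>\<open>Cmp C g f\<close> is \<open>g\<close> after \<open>f\<close>\<close>

definition Hom :: "('o, 'm) cat \<Rightarrow> 'o \<Rightarrow> 'o \<Rightarrow> 'm set" where
  "Hom C X Y = {f \<in> Arr C. Dom C f = X \<and> Cod C f = Y}"

locale category =
  fixes C :: "('o, 'm) cat"
  assumes Dom_in: "f \<in> Arr C \<Longrightarrow> Dom C f \<in> Obj C"
    and Cod_in: "f \<in> Arr C \<Longrightarrow> Cod C f \<in> Obj C"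
    and Ident_in: "X \<in> Obj C \<Longrightarrow> Ident C X \<in> Hom C X X"
    and Cmp_in: "f \<in> Hom C X Y \<Longrightarrow> g \<in> Hom C Y Z \<Longrightarrow> Cmp C g f \<in> Hom C X Z"
    and Cmp_Ident_left: "f \<in> Hom C X Y \<Longrightarrow> Cmp C (Ident C Y) f = f"
    and Cmp_Ident_right: "f \<in> Hom C X Y \<Longrightarrow> Cmp C f (Ident C X) = f"
    and Cmp_assoc: "f \<in> Hom C X Y \<Longrightarrow> g \<in> Hom C Y Z \<Longrightarrow> h \<in> Hom C Z T \<Longrightarrow>
        Cmp C h (Cmp C g f) = Cmp C (Cmp C h g) f"

record ('o, 'm, 'p, 'n) ftr =
  fObj :: "'o \<Rightarrow> 'p"
  fArr :: "'m \<Rightarrow> 'n"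

locale cat_functor = C: category C + D: category D
  for C :: "('o, 'm) cat" and D :: "('p, 'n) cat" +
  fixes F :: "('o, 'm, 'p, 'n) ftr"
  assumes fObj_in: "X \<in> Obj C \<Longrightarrow> fObj F X \<in> Obj D"
    and fArr_in: "f \<in> Hom C X Y \<Longrightarrow> fArr F f \<in> Hom D (fObj F X) (fObj F Y)"
    and fArr_Ident: "X \<in> Obj C \<Longrightarrow> fArr F (Ident C X) = Ident D (fObj F X)"
    and fArr_Cmp: "f \<in> Hom C X Y \<Longrightarrow> g \<in> Hom C Y Z \<Longrightarrow>
        fArr F (Cmp C g f) = Cmp D (fArr F g) (fArr F f)"

definition injection :: "('o, 'm) cat \<Rightarrow> ('p, 'n) cat \<Rightarrow> ('o, 'm, 'p, 'n) ftr \<Rightarrow> bool" where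
  "injection C D F \<longleftrightarrow> cat_functor C D F \<and> inj_on (fObj F) (Obj C) \<and> inj_on (fArr F) (Arr C)"

definition inverse_functors ::
  "('o, 'm) cat \<Rightarrow> ('p, 'n) cat \<Rightarrow> ('o, 'm, 'p, 'n) ftr \<Rightarrow> ('p, 'n, 'o, 'm) ftr \<Rightarrow> bool" where
  "inverse_functors C D F G \<longleftrightarrow> cat_functor C D F \<and> cat_functor D C G
     \<and> (\<forall>X\<in>Obj C. fObj G (fObj F X) = X) \<and> (\<forall>f\<in>Arr C. fArr G (fArr F f) = f)
     \<and> (\<forall>Y\<in>Obj D. fObj F (fObj G Y) = Y) \<and> (\<forall>g\<in>Arr D. fArr F (fArr G g) = g)"

definition cat_isomorphism :: "('o, 'm) cat \<Rightarrow> ('p, 'n) cat \<Rightarrow> ('o, 'm, 'p, 'n) ftr \<Rightarrow> bool" where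
  "cat_isomorphism C D F \<longleftrightarrow> (\<exists>G. inverse_functors C D F G)"

definition full_subcat :: "('o, 'm) cat \<Rightarrow> 'o set \<Rightarrow> ('o, 'm) cat" where
  "full_subcat C P = C\<lparr>Obj := Obj C \<inter> P, Arr := {f \<in> Arr C. Dom C f \<in> P \<and> Cod C f \<in> P}\<rparr>"

text \<open>The inclusion of any subcategory.\<close>

definition inclusion :: "('o, 'm, 'o, 'm) ftr" where
  "inclusion = \<lparr>fObj = (\<lambda>X. X), fArr = (\<lambda>f. f)\<rparr>"

definition op_cat :: "('o, 'm) cat \<Rightarrow> ('o, 'm) cat" where
  "op_cat C = C\<lparr>Dom := Cod C, Cod := Dom C, Cmp := (\<lambda>g f. Cmp C f g)\<rparr>"

definition prod_cat :: "('o, 'm) cat \<Rightarrow> ('p, 'n) cat \<Rightarrow> ('o \<times> 'p, 'm \<times> 'n) cat" where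
  "prod_cat C D = \<lparr>Obj = Obj C \<times> Obj D, Arr = Arr C \<times> Arr D,
     Dom = map_prod (Dom C) (Dom D), Cod = map_prod (Cod C) (Cod D),
     Ident = map_prod (Ident C) (Ident D),
     Cmp = (\<lambda>(g, g') (f, f'). (Cmp C g f, Cmp D g' f'))\<rparr>"

record ('o, 'm, 's) set_ftr =
  sObj :: "'o \<Rightarrow> 's set"
  sArr :: "'m \<Rightarrow> 's \<Rightarrow> 's"

locale set_functor = C: category C
  for C :: "('o, 'm) cat" +
  fixes F :: "('o, 'm, 's) set_ftr"
  assumes sArr_in: "f \<in> Hom C X Y \<Longrightarrow> s \<in> sObj F X \<Longrightarrow> sArr F f s \<in> sObj F Y"
    and sArr_Ident: "X \<in> Obj C \<Longrightarrow> s \<in> sObj F X \<Longrightarrow> sArr F (Ident C X) s = s"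
    and sArr_Cmp: "f \<in> Hom C X Y \<Longrightarrow> g \<in> Hom C Y Z \<Longrightarrow> s \<in> sObj F X \<Longrightarrow>
        sArr F (Cmp C g f) s = sArr F g (sArr F f s)"


section \<open>Ideals\<close>

text \<open>Hom-sets of a category are disjoint here, so a family of subsets \<open>\<S>(V, U) \<subseteq> \<W>(V, U)\<close>
  is the same as one set of arrows \<open>S\<close>, with \<open>\<S>(V, U) = S \<inter> Hom W V U\<close>.\<close>

definition cat_ideal :: "('o, 'm) cat \<Rightarrow> 'm set \<Rightarrow> bool" where
  "cat_ideal W S \<longleftrightarrow> S \<subseteq> Arr W
     \<and> (\<forall>V U U' s w. s \<in> S \<inter> Hom W V U \<longrightarrow> w \<in> Hom W U U' \<longrightarrow> Cmp W w s \<in> S)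
     \<and> (\<forall>V V' U s w. s \<in> S \<inter> Hom W V U \<longrightarrow> w \<in> Hom W V' V \<longrightarrow> Cmp W s w \<in> S)"

definition thin :: "('o, 'm) cat \<Rightarrow> 'm set \<Rightarrow> bool" where
  "thin W S \<longleftrightarrow> (\<forall>V U V' U' z u' u. z \<in> S \<inter> Hom W V U \<longrightarrow> u' \<in> Hom W V' V \<longrightarrow> u \<in> Hom W U U'
     \<longrightarrow> u' \<notin> S \<and> u \<notin> S)"

text \<open>\<open>is_path W X fs Y\<close>: the list \<open>fs\<close>, in the order in which the arrows are traversed, is a
  path from \<open>X\<close> to \<open>Y\<close>.\<close>

fun is_path :: "('o, 'm) cat \<Rightarrow> 'o \<Rightarrow> 'm list \<Rightarrow> 'o \<Rightarrow> bool" where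
  "is_path W X [] Y \<longleftrightarrow> X \<in> Obj W \<and> X = Y"
| "is_path W X (f # fs) Y \<longleftrightarrow> f \<in> Arr W \<and> Dom W f = X \<and> is_path W (Cod W f) fs Y"

definition source_cat :: "('o, 'm) cat \<Rightarrow> 'm set \<Rightarrow> ('o, 'm) cat" where
  "source_cat W S =
     full_subcat W {X. \<exists>fs Y. is_path W X fs Y \<and> fs \<noteq> [] \<and> last fs \<in> S}"

definition target_cat :: "('o, 'm) cat \<Rightarrow> 'm set \<Rightarrow> ('o, 'm) cat" where
  "target_cat W S =
     full_subcat W {Y. \<exists>fs X. is_path W X fs Y \<and> fs \<noteq> [] \<and> hd fs \<in> S}"


section \<open>Bifunctors and arrow categories\<close>

text \<open>A \<open>\<U>\<close>-\<open>\<V>\<close>-bifunctor is a functor from \<open>\<V>\<^sup>o\<^sup>p \<times> \<U>\<close> to sets.\<close>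

locale bifunctor = U: category U + V: category V + set_functor "prod_cat (op_cat V) U" S
  for U :: "('u, 'um) cat" and V :: "('v, 'vm) cat"
    and S :: "('v \<times> 'u, 'vm \<times> 'um, 's) set_ftr"

definition lact :: "('v, 'vm) cat \<Rightarrow> ('v \<times> 'u, 'vm \<times> 'um, 's) set_ftr \<Rightarrow> 'v \<Rightarrow> 'um \<Rightarrow> 's \<Rightarrow> 's" where
  "lact V S X u s = sArr S (Ident V X, u) s"

definition ract :: "('u, 'um) cat \<Rightarrow> ('v \<times> 'u, 'vm \<times> 'um, 's) set_ftr \<Rightarrow> 'u \<Rightarrow> 's \<Rightarrow> 'vm \<Rightarrow> 's" where
  "ract U S Y s v = sArr S (v, Ident U Y) s"

text \<open>The sets \<open>S(V, U)\<close> of a bifunctor need not be disjoint, so an arrow coming from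
  \<open>s \<in> S(V, U)\<close> also records its end points: it is \<open>ArrS V U s\<close>.\<close>

datatype ('v, 'vm, 'u, 'um, 's) arrow = ArrV 'vm | ArrU 'um | ArrS 'v 'u 's

fun arrow_dom :: "('u, 'um) cat \<Rightarrow> ('v, 'vm) cat \<Rightarrow> ('v, 'vm, 'u, 'um, 's) arrow \<Rightarrow> 'v + 'u" where
  "arrow_dom U V (ArrV v) = Inl (Dom V v)"
| "arrow_dom U V (ArrU u) = Inr (Dom U u)"
| "arrow_dom U V (ArrS X Y s) = Inl X"

fun arrow_cod :: "('u, 'um) cat \<Rightarrow> ('v, 'vm) cat \<Rightarrow> ('v, 'vm, 'u, 'um, 's) arrow \<Rightarrow> 'v + 'u" where
  "arrow_cod U V (ArrV v) = Inl (Cod V v)"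
| "arrow_cod U V (ArrU u) = Inr (Cod U u)"
| "arrow_cod U V (ArrS X Y s) = Inr Y"

fun arrow_cmp :: "('u, 'um) cat \<Rightarrow> ('v, 'vm) cat \<Rightarrow> ('v \<times> 'u, 'vm \<times> 'um, 's) set_ftr \<Rightarrow>
    ('v, 'vm, 'u, 'um, 's) arrow \<Rightarrow> ('v, 'vm, 'u, 'um, 's) arrow \<Rightarrow> ('v, 'vm, 'u, 'um, 's) arrow" where
  "arrow_cmp U V S (ArrV v') (ArrV v) = ArrV (Cmp V v' v)"
| "arrow_cmp U V S (ArrU u') (ArrU u) = ArrU (Cmp U u' u)"
| "arrow_cmp U V S (ArrU u) (ArrS X Y s) = ArrS X (Cod U u) (lact V S X u s)"
| "arrow_cmp U V S (ArrS X Y s) (ArrV v) = ArrS (Dom V v) Y (ract U S Y s v)"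
| "arrow_cmp U V S _ _ = undefined"

definition arrow_cat :: "('u, 'um) cat \<Rightarrow> ('v, 'vm) cat \<Rightarrow> ('v \<times> 'u, 'vm \<times> 'um, 's) set_ftr \<Rightarrow>
    ('v + 'u, ('v, 'vm, 'u, 'um, 's) arrow) cat" where
  "arrow_cat U V S = \<lparr>Obj = Obj V <+> Obj U,
     Arr = ArrV ` Arr V \<union> ArrU ` Arr U
       \<union> {ArrS X Y s | X Y s. X \<in> Obj V \<and> Y \<in> Obj U \<and> s \<in> sObj S (X, Y)},
     Dom = arrow_dom U V, Cod = arrow_cod U V,
     Ident = case_sum (\<lambda>X. ArrV (Ident V X)) (\<lambda>Y. ArrU (Ident U Y)),
     Cmp = arrow_cmp U V S\<rparr>"

text \<open>The restriction of an ideal \<open>S\<close> to a \<open>\<U>\<close>-\<open>\<V>\<close>-bifunctor for full subcategories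
  \<open>\<U>, \<V>\<close> of \<open>W\<close>. The subcategories enter only through the domain \<open>\<V>\<^sup>o\<^sup>p \<times> \<U>\<close>.\<close>

definition ideal_bifunctor :: "('o, 'm) cat \<Rightarrow> 'm set \<Rightarrow> ('o \<times> 'o, 'm \<times> 'm, 'm) set_ftr" where
  "ideal_bifunctor W S = \<lparr>sObj = (\<lambda>(X, Y). S \<inter> Hom W X Y),
     sArr = (\<lambda>(v, u) s. Cmp W u (Cmp W s v))\<rparr>"


section \<open>Graded categories\<close>

text \<open>Compositions and actions, given in the source as linear maps out of a tensor product over
  \<open>k\<close>, are rendered as the corresponding bilinear maps.\<close>

definition bilinear_map :: "'k ring \<Rightarrow> ('k, 'x) module \<Rightarrow> ('k, 'y) module \<Rightarrow> ('k, 'z) module \<Rightarrow>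
    ('x \<Rightarrow> 'y \<Rightarrow> 'z) \<Rightarrow> bool" where
  "bilinear_map k L M N f \<longleftrightarrow>
     (\<forall>x\<in>carrier L. \<forall>y\<in>carrier M. f x y \<in> carrier N)
   \<and> (\<forall>x\<in>carrier L. \<forall>x'\<in>carrier L. \<forall>y\<in>carrier M. f (x \<oplus>\<^bsub>L\<^esub> x') y = f x y \<oplus>\<^bsub>N\<^esub> f x' y)
   \<and> (\<forall>x\<in>carrier L. \<forall>y\<in>carrier M. \<forall>y'\<in>carrier M. f x (y \<oplus>\<^bsub>M\<^esub> y') = f x y \<oplus>\<^bsub>N\<^esub> f x y')
   \<and> (\<forall>r\<in>carrier k. \<forall>x\<in>carrier L. \<forall>y\<in>carrier M. f (r \<odot>\<^bsub>L\<^esub> x) y = r \<odot>\<^bsub>N\<^esub> f x y)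
   \<and> (\<forall>r\<in>carrier k. \<forall>x\<in>carrier L. \<forall>y\<in>carrier M. f x (r \<odot>\<^bsub>M\<^esub> y) = r \<odot>\<^bsub>N\<^esub> f x y)"

text \<open>\<open>gComp c g f C C' C''\<close> is the composition of the module over \<open>g\<close>, from \<open>C'\<close> to \<open>C''\<close>, with
  the module over \<open>f\<close>, from \<open>C\<close> to \<open>C'\<close>.\<close>

record ('o, 'm, 'c, 'k, 'x) gcat =
  gObj :: "'o \<Rightarrow> 'c set"
  gHom :: "'m \<Rightarrow> 'c \<Rightarrow> 'c \<Rightarrow> ('k, 'x) module"
  gComp :: "'m \<Rightarrow> 'm \<Rightarrow> 'c \<Rightarrow> 'c \<Rightarrow> 'c \<Rightarrow> 'x \<Rightarrow> 'x \<Rightarrow> 'x"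
  gId :: "'o \<Rightarrow> 'c \<Rightarrow> 'x"

locale graded_category = k: cring k + W: category W
  for k :: "'k ring" and W :: "('o, 'm) cat" +
  fixes c :: "('o, 'm, 'c, 'k, 'x) gcat"
  assumes gHom_module: "f \<in> Hom W X Y \<Longrightarrow> C \<in> gObj c X \<Longrightarrow> C' \<in> gObj c Y \<Longrightarrow>
        module k (gHom c f C C')"
    and gComp_bilinear: "f \<in> Hom W X Y \<Longrightarrow> g \<in> Hom W Y Z \<Longrightarrow>
        C \<in> gObj c X \<Longrightarrow> C' \<in> gObj c Y \<Longrightarrow> C'' \<in> gObj c Z \<Longrightarrow>
        bilinear_map k (gHom c g C' C'') (gHom c f C C') (gHom c (Cmp W g f) C C'')
          (gComp c g f C C' C'')"
    and gId_in: "X \<in> Obj W \<Longrightarrow> C \<in> gObj c X \<Longrightarrow> gId c X C \<in> carrier (gHom c (Ident W X) C C)"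
    and gComp_gId_left: "f \<in> Hom W X Y \<Longrightarrow> C \<in> gObj c X \<Longrightarrow> C' \<in> gObj c Y \<Longrightarrow>
        x \<in> carrier (gHom c f C C') \<Longrightarrow> gComp c (Ident W Y) f C C' C' (gId c Y C') x = x"
    and gComp_gId_right: "f \<in> Hom W X Y \<Longrightarrow> C \<in> gObj c X \<Longrightarrow> C' \<in> gObj c Y \<Longrightarrow>
        x \<in> carrier (gHom c f C C') \<Longrightarrow> gComp c f (Ident W X) C C C' x (gId c X C) = x"
    and gComp_assoc: "f \<in> Hom W X Y \<Longrightarrow> g \<in> Hom W Y Z \<Longrightarrow> h \<in> Hom W Z T \<Longrightarrow>
        C \<in> gObj c X \<Longrightarrow> C' \<in> gObj c Y \<Longrightarrow> C'' \<in> gObj c Z \<Longrightarrow> C''' \<in> gObj c T \<Longrightarrow>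
        x \<in> carrier (gHom c f C C') \<Longrightarrow> y \<in> carrier (gHom c g C' C'') \<Longrightarrow>
        z \<in> carrier (gHom c h C'' C''') \<Longrightarrow>
        gComp c h (Cmp W g f) C C'' C''' z (gComp c g f C C' C'' y x)
          = gComp c (Cmp W h g) f C C' C''' (gComp c h g C' C'' C''' z y) x"

text \<open>Equality of \<open>W\<close>-graded categories: equality of all data at the arguments where the data are
  meaningful (HOL functions also take irrelevant values elsewhere).\<close>

definition gcat_eq :: "('o, 'm) cat \<Rightarrow> ('o, 'm, 'c, 'k, 'x) gcat \<Rightarrow> ('o, 'm, 'c, 'k, 'x) gcat \<Rightarrow> bool" where
  "gcat_eq W c d \<longleftrightarrow>
     (\<forall>X\<in>Obj W. gObj c X = gObj d X)
   \<and> (\<forall>X Y f. f \<in> Hom W X Y \<longrightarrow>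
        (\<forall>C\<in>gObj c X. \<forall>C'\<in>gObj c Y. gHom c f C C' = gHom d f C C'))
   \<and> (\<forall>X Y Z f g. f \<in> Hom W X Y \<longrightarrow> g \<in> Hom W Y Z \<longrightarrow>
        (\<forall>C\<in>gObj c X. \<forall>C'\<in>gObj c Y. \<forall>C''\<in>gObj c Z.
         \<forall>y\<in>carrier (gHom c g C' C''). \<forall>x\<in>carrier (gHom c f C C').
           gComp c g f C C' C'' y x = gComp d g f C C' C'' y x))
   \<and> (\<forall>X\<in>Obj W. \<forall>C\<in>gObj c X. gId c X C = gId d X C)"

definition gpullback :: "('o, 'm, 'c, 'k, 'x) gcat \<Rightarrow> ('p, 'n, 'o, 'm) ftr \<Rightarrow> ('p, 'n, 'c, 'k, 'x) gcat" where
  "gpullback c F = \<lparr>gObj = (\<lambda>X. gObj c (fObj F X)), gHom = (\<lambda>f. gHom c (fArr F f)),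
     gComp = (\<lambda>g f. gComp c (fArr F g) (fArr F f)), gId = (\<lambda>X. gId c (fObj F X))\<rparr>"


section \<open>Bimodules and arrow graded categories\<close>

text \<open>For \<open>s \<in> S(X, Y)\<close>, the module \<open>M\<^sub>s(B, A)\<close> is \<open>bHom M X Y s B A\<close>. The action of the module
  over \<open>u : Y \<rightarrow> Y'\<close>, from \<open>A\<close> to \<open>A'\<close>, is \<open>bLeft M X u s B A A'\<close>; that of the module over
  \<open>v : X' \<rightarrow> X\<close>, from \<open>B'\<close> to \<open>B\<close>, is \<open>bRight M Y s v B' B A\<close>.\<close>

record ('v, 'vm, 'u, 'um, 's, 'c, 'k, 'x) bimod =
  bHom :: "'v \<Rightarrow> 'u \<Rightarrow> 's \<Rightarrow> 'c \<Rightarrow> 'c \<Rightarrow> ('k, 'x) module"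
  bLeft :: "'v \<Rightarrow> 'um \<Rightarrow> 's \<Rightarrow> 'c \<Rightarrow> 'c \<Rightarrow> 'c \<Rightarrow> 'x \<Rightarrow> 'x \<Rightarrow> 'x"
  bRight :: "'u \<Rightarrow> 's \<Rightarrow> 'vm \<Rightarrow> 'c \<Rightarrow> 'c \<Rightarrow> 'c \<Rightarrow> 'x \<Rightarrow> 'x \<Rightarrow> 'x"

locale graded_bimodule =
  A: graded_category k U a + B: graded_category k V b + S: bifunctor U V S
  for k :: "'k ring" and U :: "('u, 'um) cat" and V :: "('v, 'vm) cat"
    and a :: "('u, 'um, 'c, 'k, 'x) gcat" and b :: "('v, 'vm, 'c, 'k, 'x) gcat"
    and S :: "('v \<times> 'u, 'vm \<times> 'um, 's) set_ftr" +
  fixes M :: "('v, 'vm, 'u, 'um, 's, 'c, 'k, 'x) bimod"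
  assumes bHom_module: "X \<in> Obj V \<Longrightarrow> Y \<in> Obj U \<Longrightarrow> s \<in> sObj S (X, Y) \<Longrightarrow>
        B \<in> gObj b X \<Longrightarrow> A \<in> gObj a Y \<Longrightarrow> module k (bHom M X Y s B A)"
    and bLeft_bilinear: "X \<in> Obj V \<Longrightarrow> s \<in> sObj S (X, Y) \<Longrightarrow> u \<in> Hom U Y Y' \<Longrightarrow>
        B \<in> gObj b X \<Longrightarrow> A \<in> gObj a Y \<Longrightarrow> A' \<in> gObj a Y' \<Longrightarrow>
        bilinear_map k (gHom a u A A') (bHom M X Y s B A) (bHom M X Y' (lact V S X u s) B A')
          (bLeft M X u s B A A')"
    and bRight_bilinear: "Y \<in> Obj U \<Longrightarrow> s \<in> sObj S (X, Y) \<Longrightarrow> v \<in> Hom V X' X \<Longrightarrow>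
        B' \<in> gObj b X' \<Longrightarrow> B \<in> gObj b X \<Longrightarrow> A \<in> gObj a Y \<Longrightarrow>
        bilinear_map k (bHom M X Y s B A) (gHom b v B' B) (bHom M X' Y (ract U S Y s v) B' A)
          (bRight M Y s v B' B A)"
    and bLeft_gId: "X \<in> Obj V \<Longrightarrow> Y \<in> Obj U \<Longrightarrow> s \<in> sObj S (X, Y) \<Longrightarrow>
        B \<in> gObj b X \<Longrightarrow> A \<in> gObj a Y \<Longrightarrow> m \<in> carrier (bHom M X Y s B A) \<Longrightarrow>
        bLeft M X (Ident U Y) s B A A (gId a Y A) m = m"
    and bRight_gId: "X \<in> Obj V \<Longrightarrow> Y \<in> Obj U \<Longrightarrow> s \<in> sObj S (X, Y) \<Longrightarrow>
        B \<in> gObj b X \<Longrightarrow> A \<in> gObj a Y \<Longrightarrow> m \<in> carrier (bHom M X Y s B A) \<Longrightarrow>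
        bRight M Y s (Ident V X) B B A m (gId b X B) = m"
    and bLeft_assoc: "X \<in> Obj V \<Longrightarrow> s \<in> sObj S (X, Y) \<Longrightarrow> u \<in> Hom U Y Y' \<Longrightarrow> u' \<in> Hom U Y' Y'' \<Longrightarrow>
        B \<in> gObj b X \<Longrightarrow> A \<in> gObj a Y \<Longrightarrow> A' \<in> gObj a Y' \<Longrightarrow> A'' \<in> gObj a Y'' \<Longrightarrow>
        m \<in> carrier (bHom M X Y s B A) \<Longrightarrow> x \<in> carrier (gHom a u A A') \<Longrightarrow>
        x' \<in> carrier (gHom a u' A' A'') \<Longrightarrow>
        bLeft M X u' (lact V S X u s) B A' A'' x' (bLeft M X u s B A A' x m)
          = bLeft M X (Cmp U u' u) s B A A'' (gComp a u' u A A' A'' x' x) m"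
    and bRight_assoc: "Y \<in> Obj U \<Longrightarrow> s \<in> sObj S (X, Y) \<Longrightarrow> v \<in> Hom V X' X \<Longrightarrow> v' \<in> Hom V X'' X' \<Longrightarrow>
        B'' \<in> gObj b X'' \<Longrightarrow> B' \<in> gObj b X' \<Longrightarrow> B \<in> gObj b X \<Longrightarrow> A \<in> gObj a Y \<Longrightarrow>
        m \<in> carrier (bHom M X Y s B A) \<Longrightarrow> y \<in> carrier (gHom b v B' B) \<Longrightarrow>
        y' \<in> carrier (gHom b v' B'' B') \<Longrightarrow>
        bRight M Y (ract U S Y s v) v' B'' B' A (bRight M Y s v B' B A m y) y'
          = bRight M Y s (Cmp V v v') B'' B A m (gComp b v v' B'' B' B y y')"
    and bLeft_bRight: "s \<in> sObj S (X, Y) \<Longrightarrow> u \<in> Hom U Y Y' \<Longrightarrow> v \<in> Hom V X' X \<Longrightarrow>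
        B' \<in> gObj b X' \<Longrightarrow> B \<in> gObj b X \<Longrightarrow> A \<in> gObj a Y \<Longrightarrow> A' \<in> gObj a Y' \<Longrightarrow>
        m \<in> carrier (bHom M X Y s B A) \<Longrightarrow> x \<in> carrier (gHom a u A A') \<Longrightarrow>
        y \<in> carrier (gHom b v B' B) \<Longrightarrow>
        bLeft M X' u (ract U S Y s v) B' A A' x (bRight M Y s v B' B A m y)
          = bRight M Y' (lact V S X u s) v B' B A' (bLeft M X u s B A A' x m) y"

fun arrow_gObj :: "('u, 'um, 'c, 'k, 'x) gcat \<Rightarrow> ('v, 'vm, 'c, 'k, 'x) gcat \<Rightarrow> 'v + 'u \<Rightarrow> 'c set" where
  "arrow_gObj a b (Inl X) = gObj b X"
| "arrow_gObj a b (Inr Y) = gObj a Y"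

fun arrow_gHom :: "('u, 'um, 'c, 'k, 'x) gcat \<Rightarrow> ('v, 'vm, 'c, 'k, 'x) gcat \<Rightarrow>
    ('v, 'vm, 'u, 'um, 's, 'c, 'k, 'x) bimod \<Rightarrow> ('v, 'vm, 'u, 'um, 's) arrow \<Rightarrow>
    'c \<Rightarrow> 'c \<Rightarrow> ('k, 'x) module" where
  "arrow_gHom a b M (ArrV v) = gHom b v"
| "arrow_gHom a b M (ArrU u) = gHom a u"
| "arrow_gHom a b M (ArrS X Y s) = bHom M X Y s"

fun arrow_gComp :: "('u, 'um, 'c, 'k, 'x) gcat \<Rightarrow> ('v, 'vm, 'c, 'k, 'x) gcat \<Rightarrow>
    ('v, 'vm, 'u, 'um, 's, 'c, 'k, 'x) bimod \<Rightarrow> ('v, 'vm, 'u, 'um, 's) arrow \<Rightarrow>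
    ('v, 'vm, 'u, 'um, 's) arrow \<Rightarrow> 'c \<Rightarrow> 'c \<Rightarrow> 'c \<Rightarrow> 'x \<Rightarrow> 'x \<Rightarrow> 'x" where
  "arrow_gComp a b M (ArrV v') (ArrV v) = gComp b v' v"
| "arrow_gComp a b M (ArrU u') (ArrU u) = gComp a u' u"
| "arrow_gComp a b M (ArrU u) (ArrS X Y s) = bLeft M X u s"
| "arrow_gComp a b M (ArrS X Y s) (ArrV v) = bRight M Y s v"
| "arrow_gComp a b M _ _ = undefined"

fun arrow_gId :: "('u, 'um, 'c, 'k, 'x) gcat \<Rightarrow> ('v, 'vm, 'c, 'k, 'x) gcat \<Rightarrow> 'v + 'u \<Rightarrow> 'c \<Rightarrow> 'x" where
  "arrow_gId a b (Inl X) = gId b X"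
| "arrow_gId a b (Inr Y) = gId a Y"

definition arrow_gcat :: "('u, 'um, 'c, 'k, 'x) gcat \<Rightarrow> ('v, 'vm, 'c, 'k, 'x) gcat \<Rightarrow>
    ('v, 'vm, 'u, 'um, 's, 'c, 'k, 'x) bimod \<Rightarrow>
    ('v + 'u, ('v, 'vm, 'u, 'um, 's) arrow, 'c, 'k, 'x) gcat" where
  "arrow_gcat a b M = \<lparr>gObj = arrow_gObj a b, gHom = arrow_gHom a b M,
     gComp = arrow_gComp a b M, gId = arrow_gId a b\<rparr>"

text \<open>The identity bimodule \<open>1\<^sub>c\<close>. As in \<open>ideal_bifunctor\<close>, its restriction to \<open>S\<close> is given by the
  same functions, only with \<open>s\<close>, \<open>B\<close>, \<open>A\<close> ranging over \<open>S(V, U)\<close>, \<open>\<bb>\<^sub>V\<close>, \<open>\<aa>\<^sub>U\<close>.\<close>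

definition identity_bimodule ::
  "('o, 'm, 'c, 'k, 'x) gcat \<Rightarrow> ('o, 'm, 'o, 'm, 'm, 'c, 'k, 'x) bimod" where
  "identity_bimodule c = \<lparr>bHom = (\<lambda>X Y s. gHom c s), bLeft = (\<lambda>X u s. gComp c u s),
     bRight = (\<lambda>Y s v. gComp c s v)\<rparr>"


section \<open>Well-formedness of the constructions\<close>

lemma HomD: "f \<in> Hom C X Y \<Longrightarrow> f \<in> Arr C \<and> Dom C f = X \<and> Cod C f = Y"
  by (simp add: Hom_def)

lemma (in category) Hom_Obj: "f \<in> Hom C X Y \<Longrightarrow> X \<in> Obj C \<and> Y \<in> Obj C"
  using Dom_in Cod_in by (auto simp: Hom_def)

lemma Hom_full_subcat:
  "f \<in> Hom (full_subcat W P) X Y \<longleftrightarrow> f \<in> Hom W X Y \<and> X \<in> P \<and> Y \<in> P"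
  by (auto simp: Hom_def full_subcat_def)

lemma full_subcat_sel [simp]:
  "Obj (full_subcat W P) = Obj W \<inter> P" "Dom (full_subcat W P) = Dom W"
  "Cod (full_subcat W P) = Cod W" "Ident (full_subcat W P) = Ident W"
  "Cmp (full_subcat W P) = Cmp W"
  by (simp_all add: full_subcat_def)

lemma category_full_subcat:
  assumes "category W" shows "category (full_subcat W P)"
proof -
  interpret W: category W by fact
  show ?thesis
    apply unfold_locales
          apply (simp_all add: Hom_full_subcat W.Ident_in)
        apply (auto simp: full_subcat_def W.Dom_in W.Cod_in)[2]
      apply (blast intro: W.Cmp_in)
     apply (auto intro: W.Cmp_Ident_left W.Cmp_Ident_right W.Cmp_assoc)
    done
qed

lemma cat_functor_inclusion:
  assumes "category W" shows "cat_functor (full_subcat W P) W inclusion"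
proof -
  interpret W: category W by fact
  interpret P: category "full_subcat W P" by (rule category_full_subcat) fact
  show ?thesis by unfold_locales (auto simp: inclusion_def Hom_full_subcat)
qed

lemma graded_category_gpullback:
  assumes "graded_category k W c" "cat_functor X W F"
  shows "graded_category k X (gpullback c F)"
proof -
  interpret c: graded_category k W c by fact
  interpret F: cat_functor X W F by fact
  show ?thesis
    apply (intro graded_category.intro graded_category_axioms.intro c.k.cring_axioms
        F.C.category_axioms)
         apply (simp_all add: gpullback_def F.fArr_Cmp F.fArr_Ident)
         apply (meson c.gHom_module F.fArr_in)
        apply (meson c.gComp_bilinear F.fArr_in)
       apply (meson c.gId_in F.fObj_in)
      apply (metis F.C.Hom_Obj F.fArr_Ident c.gComp_gId_left F.fArr_in)
     apply (metis F.C.Hom_Obj F.fArr_Ident c.gComp_gId_right F.fArr_in)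
    apply (rule c.gComp_assoc; (rule F.fArr_in)?; assumption)
    done
qed

lemma Hom_op_cat: "f \<in> Hom (op_cat C) X Y \<longleftrightarrow> f \<in> Hom C Y X"
  by (auto simp: Hom_def op_cat_def)

lemma Hom_prod_cat:
  "p \<in> Hom (prod_cat C D) X Y \<longleftrightarrow>
     fst p \<in> Hom C (fst X) (fst Y) \<and> snd p \<in> Hom D (snd X) (snd Y)"
  by (cases p; cases X; cases Y) (auto simp: Hom_def prod_cat_def)

lemma op_cat_sel [simp]:
  "Obj (op_cat C) = Obj C" "Arr (op_cat C) = Arr C" "Ident (op_cat C) = Ident C"
  "Dom (op_cat C) = Cod C" "Cod (op_cat C) = Dom C" "Cmp (op_cat C) g f = Cmp C f g"
  by (simp_all add: op_cat_def)

lemma prod_cat_sel [simp]: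
  "Obj (prod_cat C D) = Obj C \<times> Obj D" "Arr (prod_cat C D) = Arr C \<times> Arr D"
  "Ident (prod_cat C D) p = (Ident C (fst p), Ident D (snd p))"
  "Dom (prod_cat C D) q = (Dom C (fst q), Dom D (snd q))"
  "Cod (prod_cat C D) q = (Cod C (fst q), Cod D (snd q))"
  "Cmp (prod_cat C D) q r = (Cmp C (fst q) (fst r), Cmp D (snd q) (snd r))"
  by (cases p; cases q; cases r; simp add: prod_cat_def)+

lemma category_op_cat:
  assumes "category C" shows "category (op_cat C)"
proof -
  interpret category C by fact
  show ?thesis
    by unfold_locales
      (auto simp: Hom_op_cat Dom_in Cod_in Cmp_Ident_left Cmp_Ident_right
        intro: Ident_in Cmp_in Cmp_assoc[symmetric])
qed

lemma category_prod_cat: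
  assumes "category C" "category D" shows "category (prod_cat C D)"
proof -
  interpret C: category C by fact
  interpret D: category D by fact
  show ?thesis
    apply unfold_locales
          apply (auto simp: Hom_prod_cat C.Dom_in C.Cod_in D.Dom_in D.Cod_in
        C.Cmp_Ident_left C.Cmp_Ident_right D.Cmp_Ident_left D.Cmp_Ident_right
        C.Cmp_assoc D.Cmp_assoc intro: C.Ident_in D.Ident_in)
       apply (blast intro: C.Cmp_in D.Cmp_in C.Cmp_assoc D.Cmp_assoc)+
    done
qed

lemma bifunctor_ideal_bifunctor:
  assumes "category W" "cat_ideal W S"
  shows "bifunctor (full_subcat W P) (full_subcat W Q) (ideal_bifunctor W S)"
proof -
  interpret W: category W by fact
  interpret P: category "full_subcat W P" by (rule category_full_subcat) fact
  interpret Q: category "full_subcat W Q" by (rule category_full_subcat) fact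
  interpret PQ: category "prod_cat (op_cat (full_subcat W Q)) (full_subcat W P)"
    by (intro category_prod_cat category_op_cat P.category_axioms Q.category_axioms)
  have L: "s \<in> S \<Longrightarrow> s \<in> Hom W V U \<Longrightarrow> w \<in> Hom W U U' \<Longrightarrow> Cmp W w s \<in> S"
    and R: "s \<in> S \<Longrightarrow> s \<in> Hom W V U \<Longrightarrow> w \<in> Hom W V' V \<Longrightarrow> Cmp W s w \<in> S" for s w U V U' V'
    using assms(2) unfolding cat_ideal_def by blast+
  show ?thesis
  proof unfold_locales
    fix f X Y s
    assume f: "f \<in> Hom (prod_cat (op_cat (full_subcat W Q)) (full_subcat W P)) X Y"
      and s: "s \<in> sObj (ideal_bifunctor W S) X"
    obtain v u where [simp]: "f = (v, u)" by (cases f)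
    from f have v: "v \<in> Hom W (fst Y) (fst X)" and u: "u \<in> Hom W (snd X) (snd Y)"
      by (auto simp: Hom_prod_cat Hom_op_cat Hom_full_subcat)
    from s have s: "s \<in> S" "s \<in> Hom W (fst X) (snd X)"
      by (auto simp: ideal_bifunctor_def split: prod.splits)
    show "sArr (ideal_bifunctor W S) f s \<in> sObj (ideal_bifunctor W S) Y"
      using W.Cmp_in[OF W.Cmp_in[OF v s(2)] u] L[OF R[OF s v] W.Cmp_in[OF v s(2)] u]
      by (auto simp: ideal_bifunctor_def split: prod.splits)
  next
    fix X s
    assume "s \<in> sObj (ideal_bifunctor W S) X"
    then have "s \<in> Hom W (fst X) (snd X)"
      by (auto simp: ideal_bifunctor_def split: prod.splits)
    then show "sArr (ideal_bifunctor W S)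
        (Ident (prod_cat (op_cat (full_subcat W Q)) (full_subcat W P)) X) s = s"
      by (simp add: ideal_bifunctor_def W.Cmp_Ident_left W.Cmp_Ident_right)
  next
    fix f X Y g Z s
    assume f: "f \<in> Hom (prod_cat (op_cat (full_subcat W Q)) (full_subcat W P)) X Y"
      and g: "g \<in> Hom (prod_cat (op_cat (full_subcat W Q)) (full_subcat W P)) Y Z"
      and s: "s \<in> sObj (ideal_bifunctor W S) X"
    obtain v u v' u' where [simp]: "f = (v, u)" "g = (v', u')" by (cases f; cases g)
    from f have v: "v \<in> Hom W (fst Y) (fst X)" and u: "u \<in> Hom W (snd X) (snd Y)"
      by (auto simp: Hom_prod_cat Hom_op_cat Hom_full_subcat)
    from g have v': "v' \<in> Hom W (fst Z) (fst Y)" and u': "u' \<in> Hom W (snd Y) (snd Z)"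
      by (auto simp: Hom_prod_cat Hom_op_cat Hom_full_subcat)
    from s have s: "s \<in> Hom W (fst X) (snd X)"
      by (auto simp: ideal_bifunctor_def split: prod.splits)
    note vs = W.Cmp_in[OF v s] and v's = W.Cmp_in[OF v' W.Cmp_in[OF v s]]
    show "sArr (ideal_bifunctor W S)
        (Cmp (prod_cat (op_cat (full_subcat W Q)) (full_subcat W P)) g f) s
      = sArr (ideal_bifunctor W S) g (sArr (ideal_bifunctor W S) f s)"
      using W.Cmp_assoc[OF v' v s] W.Cmp_assoc[OF v's u u'] W.Cmp_assoc[OF v' vs u]
      by (simp add: ideal_bifunctor_def)
  qed
qed

lemma graded_bimodule_identity_bimodule:
  assumes "graded_category k W c" "cat_ideal W S"
  shows "graded_bimodule k (full_subcat W P) (full_subcat W Q) (gpullback c inclusion)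
     (gpullback c inclusion) (ideal_bifunctor W S) (identity_bimodule c)"
proof -
  interpret c: graded_category k W c by fact
  have cat: "category W" by unfold_locales
  have gr: "graded_category k (full_subcat W R) (gpullback c inclusion)" for R
    by (rule graded_category_gpullback[OF assms(1) cat_functor_inclusion[OF cat]])
  have lact: "lact (full_subcat W Q) (ideal_bifunctor W S) X u s = Cmp W u s"
    and ract: "ract (full_subcat W P) (ideal_bifunctor W S) Y s v = Cmp W s v"
    if "s \<in> Hom W X Y" "u \<in> Hom W Y Y'" "v \<in> Hom W X' X" for X X' Y Y' s u v
    using that c.W.Cmp_in[OF that(3,1)]
    by (auto simp: lact_def ract_def ideal_bifunctor_def c.W.Cmp_Ident_left c.W.Cmp_Ident_right)
  have lact': "lact (full_subcat W Q) (ideal_bifunctor W S) X u s = Cmp W u s"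
    if "s \<in> Hom W X Y" "u \<in> Hom W Y Y'" for X Y Y' s u
    using lact[OF that] c.W.Ident_in c.W.Hom_Obj[OF that(1)] by blast
  have ract': "ract (full_subcat W P) (ideal_bifunctor W S) Y s v = Cmp W s v"
    if "s \<in> Hom W X Y" "v \<in> Hom W X' X" for X X' Y s v
    using ract[OF that(1) _ that(2)] c.W.Ident_in c.W.Hom_Obj[OF that(1)] by blast
  have sO: "s \<in> sObj (ideal_bifunctor W S) (X, Y) \<longleftrightarrow> s \<in> S \<and> s \<in> Hom W X Y" for s X Y
    by (simp add: ideal_bifunctor_def)
  show ?thesis
    apply (intro graded_bimodule.intro graded_bimodule_axioms.intro gr
        bifunctor_ideal_bifunctor[OF cat assms(2)])
           apply (simp_all add: sO Hom_full_subcat lact' ract' gpullback_def inclusion_def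
        identity_bimodule_def)
           apply (metis c.gHom_module)
          apply (metis c.gComp_bilinear lact')
         apply (metis c.gComp_bilinear ract')
        apply (metis c.gComp_gId_left)
       apply (metis c.gComp_gId_right)
      apply (elim conjE, subst lact', assumption, assumption, rule c.gComp_assoc; assumption)
     apply (elim conjE, subst ract', assumption, assumption,
        rule c.gComp_assoc[symmetric]; assumption)
    apply (elim conjE, subst lact', assumption, assumption, subst ract', assumption, assumption,
        rule c.gComp_assoc; assumption)
    done
qed

lemma arrow_cat_sel [simp]:
  "Obj (arrow_cat U V S) = Obj V <+> Obj U"
  "Ident (arrow_cat U V S) (Inl X) = ArrV (Ident V X)"
  "Ident (arrow_cat U V S) (Inr Y) = ArrU (Ident U Y)"
  "Cmp (arrow_cat U V S) = arrow_cmp U V S"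
  by (simp_all add: arrow_cat_def)

lemma Hom_arrow_cat [simp]:
  "Hom (arrow_cat U V S) (Inl X) (Inl X') = ArrV ` Hom V X X'"
  "Hom (arrow_cat U V S) (Inr Y) (Inr Y') = ArrU ` Hom U Y Y'"
  "Hom (arrow_cat U V S) (Inl X) (Inr Y) =
     {ArrS X Y s | s. X \<in> Obj V \<and> Y \<in> Obj U \<and> s \<in> sObj S (X, Y)}"
  "Hom (arrow_cat U V S) (Inr Y) (Inl X) = {}"
  by (auto simp: Hom_def arrow_cat_def)

context bifunctor
begin

lemma lact_in:
  "X \<in> Obj V \<Longrightarrow> s \<in> sObj S (X, Y) \<Longrightarrow> u \<in> Hom U Y Y' \<Longrightarrow> lact V S X u s \<in> sObj S (X, Y')"
  unfolding lact_def
  by (rule sArr_in[of _ "(X, Y)"]) (auto simp: Hom_prod_cat Hom_op_cat V.Ident_in)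

lemma ract_in:
  "Y \<in> Obj U \<Longrightarrow> s \<in> sObj S (X, Y) \<Longrightarrow> v \<in> Hom V X' X \<Longrightarrow> ract U S Y s v \<in> sObj S (X', Y)"
  unfolding ract_def
  by (rule sArr_in[of _ "(X, Y)"]) (auto simp: Hom_prod_cat Hom_op_cat U.Ident_in)

lemma lact_Ident: "X \<in> Obj V \<Longrightarrow> Y \<in> Obj U \<Longrightarrow> s \<in> sObj S (X, Y) \<Longrightarrow> lact V S X (Ident U Y) s = s"
  using sArr_Ident[of "(X, Y)" s] by (simp add: lact_def)

lemma ract_Ident: "X \<in> Obj V \<Longrightarrow> Y \<in> Obj U \<Longrightarrow> s \<in> sObj S (X, Y) \<Longrightarrow> ract U S Y s (Ident V X) = s"
  using sArr_Ident[of "(X, Y)" s] by (simp add: ract_def)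

lemma lact_lact:
  "X \<in> Obj V \<Longrightarrow> s \<in> sObj S (X, Y) \<Longrightarrow> u \<in> Hom U Y Y' \<Longrightarrow> u' \<in> Hom U Y' Y'' \<Longrightarrow>
     lact V S X u' (lact V S X u s) = lact V S X (Cmp U u' u) s"
  unfolding lact_def
  using sArr_Cmp[of "(Ident V X, u)" "(X, Y)" "(X, Y')" "(Ident V X, u')" "(X, Y'')" s]
    V.Cmp_Ident_left[OF V.Ident_in[of X]]
  by (simp add: Hom_prod_cat Hom_op_cat V.Ident_in)

lemma ract_ract:
  "Y \<in> Obj U \<Longrightarrow> s \<in> sObj S (X, Y) \<Longrightarrow> v \<in> Hom V X' X \<Longrightarrow> v' \<in> Hom V X'' X' \<Longrightarrow>
     ract U S Y (ract U S Y s v) v' = ract U S Y s (Cmp V v v')"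
  unfolding ract_def
  using sArr_Cmp[of "(v, Ident U Y)" "(X, Y)" "(X', Y)" "(v', Ident U Y)" "(X'', Y)" s]
    U.Cmp_Ident_left[OF U.Ident_in[of Y]]
  by (simp add: Hom_prod_cat Hom_op_cat U.Ident_in)

lemma lact_ract:
  assumes s: "s \<in> sObj S (X, Y)" and u: "u \<in> Hom U Y Y'" and v: "v \<in> Hom V X' X"
  shows "lact V S X' u (ract U S Y s v) = ract U S Y' (lact V S X u s) v"
proof -
  note O = U.Hom_Obj[OF u] V.Hom_Obj[OF v]
  have "lact V S X' u (ract U S Y s v) = sArr S (v, u) s"
    unfolding lact_def ract_def
    using sArr_Cmp[of "(v, Ident U Y)" "(X, Y)" "(X', Y)" "(Ident V X', u)" "(X', Y')" s] O s u v
      V.Cmp_Ident_right[OF v] U.Cmp_Ident_right[OF u]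
    by (simp add: Hom_prod_cat Hom_op_cat U.Ident_in V.Ident_in)
  also have "\<dots> = ract U S Y' (lact V S X u s) v"
    unfolding lact_def ract_def
    using sArr_Cmp[of "(Ident V X, u)" "(X, Y)" "(X, Y')" "(v, Ident U Y')" "(X', Y')" s] O s u v
      V.Cmp_Ident_left[OF v] U.Cmp_Ident_left[OF u]
    by (simp add: Hom_prod_cat Hom_op_cat U.Ident_in V.Ident_in)
  finally show ?thesis .
qed

lemma category_arrow_cat: "category (arrow_cat U V S)"
proof
  fix f assume "f \<in> Arr (arrow_cat U V S)"
  then show "Dom (arrow_cat U V S) f \<in> Obj (arrow_cat U V S)"
    and "Cod (arrow_cat U V S) f \<in> Obj (arrow_cat U V S)"
    by (auto simp: arrow_cat_def U.Dom_in V.Dom_in U.Cod_in V.Cod_in)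
next
  fix X assume "X \<in> Obj (arrow_cat U V S)"
  then show "Ident (arrow_cat U V S) X \<in> Hom (arrow_cat U V S) X X"
    by (auto simp: U.Ident_in V.Ident_in)
next
  fix f X Y g Z
  assume "f \<in> Hom (arrow_cat U V S) X Y" "g \<in> Hom (arrow_cat U V S) Y Z"
  then show "Cmp (arrow_cat U V S) g f \<in> Hom (arrow_cat U V S) X Z"
    by (cases X; cases Y; cases Z)
      (auto intro: U.Cmp_in V.Cmp_in lact_in ract_in dest: HomD U.Hom_Obj V.Hom_Obj)
next
  fix f X Y
  assume "f \<in> Hom (arrow_cat U V S) X Y"
  then show "Cmp (arrow_cat U V S) (Ident (arrow_cat U V S) Y) f = f"
    and "Cmp (arrow_cat U V S) f (Ident (arrow_cat U V S) X) = f"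
    by (cases X; cases Y; auto simp: U.Cmp_Ident_left V.Cmp_Ident_left U.Cmp_Ident_right
        V.Cmp_Ident_right lact_Ident ract_Ident HomD[OF U.Ident_in] HomD[OF V.Ident_in])+
next
  fix f X Y g Z h T
  assume "f \<in> Hom (arrow_cat U V S) X Y" "g \<in> Hom (arrow_cat U V S) Y Z"
    "h \<in> Hom (arrow_cat U V S) Z T"
  then show "Cmp (arrow_cat U V S) h (Cmp (arrow_cat U V S) g f)
      = Cmp (arrow_cat U V S) (Cmp (arrow_cat U V S) h g) f"
    apply (cases X; cases Y; cases Z; cases T)
                   apply (auto simp: U.Cmp_assoc V.Cmp_assoc lact_lact ract_ract)
      apply (metis HomD V.Cmp_in)
     apply (frule HomD[of _ V], frule HomD[of _ U], simp add: lact_ract)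
    apply (metis HomD U.Cmp_in)
    done
qed

end

lemma arrow_gcat_sel [simp]:
  "gObj (arrow_gcat a b M) = arrow_gObj a b" "gHom (arrow_gcat a b M) = arrow_gHom a b M"
  "gComp (arrow_gcat a b M) = arrow_gComp a b M" "gId (arrow_gcat a b M) = arrow_gId a b"
  by (simp_all add: arrow_gcat_def)

context graded_bimodule
begin

lemma graded_category_arrow_gcat: "graded_category k (arrow_cat U V S) (arrow_gcat a b M)"
proof (intro graded_category.intro graded_category_axioms.intro A.k.cring_axioms
    S.category_arrow_cat)
  fix f X Y C C'
  assume "f \<in> Hom (arrow_cat U V S) X Y" "C \<in> gObj (arrow_gcat a b M) X"
    "C' \<in> gObj (arrow_gcat a b M) Y"
  then show "module k (gHom (arrow_gcat a b M) f C C')"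
    by (cases X; cases Y) (auto intro: A.gHom_module B.gHom_module bHom_module)
next
  fix f X Y g Z C C' C''
  assume "f \<in> Hom (arrow_cat U V S) X Y" "g \<in> Hom (arrow_cat U V S) Y Z"
    "C \<in> gObj (arrow_gcat a b M) X" "C' \<in> gObj (arrow_gcat a b M) Y"
    "C'' \<in> gObj (arrow_gcat a b M) Z"
  then show "bilinear_map k (gHom (arrow_gcat a b M) g C' C'') (gHom (arrow_gcat a b M) f C C')
      (gHom (arrow_gcat a b M) (Cmp (arrow_cat U V S) g f) C C'')
      (gComp (arrow_gcat a b M) g f C C' C'')"
    apply (cases X; cases Y; cases Z)
           apply (auto intro: A.gComp_bilinear B.gComp_bilinear)
     apply (frule HomD[of _ V]; simp add: bRight_bilinear)
    apply (frule HomD[of _ U]; simp add: bLeft_bilinear)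
    done
next
  fix X C
  assume "X \<in> Obj (arrow_cat U V S)" "C \<in> gObj (arrow_gcat a b M) X"
  then show "gId (arrow_gcat a b M) X C
      \<in> carrier (gHom (arrow_gcat a b M) (Ident (arrow_cat U V S) X) C C)"
    by (auto simp: A.gId_in B.gId_in)
next
  fix f X Y C C' x
  assume "f \<in> Hom (arrow_cat U V S) X Y" "C \<in> gObj (arrow_gcat a b M) X"
    "C' \<in> gObj (arrow_gcat a b M) Y" "x \<in> carrier (gHom (arrow_gcat a b M) f C C')"
  then show "gComp (arrow_gcat a b M) (Ident (arrow_cat U V S) Y) f C C' C'
        (gId (arrow_gcat a b M) Y C') x = x"
    and "gComp (arrow_gcat a b M) f (Ident (arrow_cat U V S) X) C C C' x
        (gId (arrow_gcat a b M) X C) = x"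
    by (cases X; cases Y; auto simp: A.gComp_gId_left B.gComp_gId_left A.gComp_gId_right
        B.gComp_gId_right bLeft_gId bRight_gId)+
next
  fix f X Y g Z h T C C' C'' C''' x y z
  assume "f \<in> Hom (arrow_cat U V S) X Y" "g \<in> Hom (arrow_cat U V S) Y Z"
    "h \<in> Hom (arrow_cat U V S) Z T"
    "C \<in> gObj (arrow_gcat a b M) X" "C' \<in> gObj (arrow_gcat a b M) Y"
    "C'' \<in> gObj (arrow_gcat a b M) Z" "C''' \<in> gObj (arrow_gcat a b M) T"
    "x \<in> carrier (gHom (arrow_gcat a b M) f C C')"
    "y \<in> carrier (gHom (arrow_gcat a b M) g C' C'')"
    "z \<in> carrier (gHom (arrow_gcat a b M) h C'' C''')"
  then show "gComp (arrow_gcat a b M) h (Cmp (arrow_cat U V S) g f) C C'' C''' z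
        (gComp (arrow_gcat a b M) g f C C' C'' y x)
      = gComp (arrow_gcat a b M) (Cmp (arrow_cat U V S) h g) f C C' C'''
        (gComp (arrow_gcat a b M) h g C' C'' C''' z y) x"
    apply (cases X; cases Y; cases Z; cases T)
                   apply (auto simp: A.gComp_assoc B.gComp_assoc)
      apply (frule HomD[of _ V]; simp add: bRight_assoc)
     apply (frule HomD[of _ V], frule HomD[of _ U], simp add: bLeft_bRight)
    apply (frule HomD[of _ U], simp add: bLeft_assoc)
    done
qed

end

end

theory Submission
  imports Defs
begin

text \<open>
  Composing a path whose last map lies in the ideal \<open>\<S>\<close> gives a single arrow of \<open>\<S>\<close>, so the
  objects of \<open>\<V>\<close> are just the sources of arrows of \<open>\<S>\<close>, and dually those of \<open>\<U>\<close> are the targets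
  (\<open>Obj_source_cat\<close>, \<open>Obj_target_cat\<close>).  An arrow \<open>Y \<rightarrow> X\<close> from \<open>\<U>\<close> to \<open>\<V>\<close> would therefore sit
  between an arrow of \<open>\<S>\<close> ending at \<open>Y\<close> and one starting at \<open>X\<close>; its composite with the former
  lies in \<open>\<S>\<close> and is composable with the latter, which thinness forbids (\<open>no_arrow_back\<close>).
  Applied to identities this makes \<open>\<U>\<close> and \<open>\<V>\<close> disjoint.

  The functor \<open>\<phi>\<close> sends an arrow of the arrow category to the arrow of \<open>\<W>\<close> it came from
  (\<open>arrow_forget\<close>). It is a functor for any ideal and any two full subcategories; disjointness of
  their objects is what makes it injective, since the end points of an arrow of \<open>\<W>\<close> then
  determine of which of the three kinds its preimage is.  Given injectivity, \<open>\<phi>\<close> is an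
  isomorphism exactly if it is surjective on objects and arrows, which is the second condition:
  the absence of arrows from \<open>\<U>\<close> to \<open>\<V>\<close> leaves only the arrows from \<open>\<V>\<close> to \<open>\<U>\<close> to be tested.

  The graded categories over the arrow category agree because all the data involved are those of
  \<open>\<cc>\<close> itself, and pulling this equality back along an inverse of \<open>\<phi>\<close> gives the last claim.
\<close>

section \<open>Inverting injective functors\<close>

text \<open>The inverse is a functor because \<open>F\<close> reflects end points: if \<open>F f\<close> runs from \<open>X\<close> to \<open>Y\<close>, then
  injectivity on objects forces the end points of \<open>f\<close> to be the preimages of \<open>X\<close> and \<open>Y\<close>.\<close>

lemma injection_surj_imp_isomorphism:
  assumes inj: "injection C D F"
    and surj: "Obj D \<subseteq> fObj F ` Obj C" "Arr D \<subseteq> fArr F ` Arr C"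
  shows "cat_isomorphism C D F"
proof -
  interpret F: cat_functor C D F using inj by (simp add: injection_def)
  have injO: "inj_on (fObj F) (Obj C)" and injA: "inj_on (fArr F) (Arr C)"
    using inj by (simp_all add: injection_def)
  define G where "G = \<lparr>fObj = the_inv_into (Obj C) (fObj F), fArr = the_inv_into (Arr C) (fArr F)\<rparr>"
  have GF: "fObj G (fObj F X) = X" if "X \<in> Obj C" for X
    using that injO by (simp add: G_def the_inv_into_f_f)
  have GFa: "fArr G (fArr F f) = f" if "f \<in> Arr C" for f
    using that injA by (simp add: G_def the_inv_into_f_f)
  have obj: "\<exists>X\<in>Obj C. Y = fObj F X" if "Y \<in> Obj D" for Y using that surj by blast
  have arr: "\<exists>f. f \<in> Hom C (fObj G X) (fObj G Y) \<and> fArr G g = f \<and> fArr F f = g"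
    if g: "g \<in> Hom D X Y" for g X Y
  proof -
    from g surj obtain f where f: "f \<in> Arr C" "fArr F f = g" by (auto simp: Hom_def)
    then have h: "f \<in> Hom C (Dom C f) (Cod C f)" by (simp add: Hom_def)
    have "X = fObj F (Dom C f)" "Y = fObj F (Cod C f)"
      using HomD[OF F.fArr_in[OF h]] HomD[OF g] f by simp_all
    then show ?thesis using f h F.C.Dom_in F.C.Cod_in by (auto simp: GF GFa)
  qed
  have "cat_functor D C G"
  proof
    fix X assume "X \<in> Obj D"
    then obtain X' where X': "X' \<in> Obj C" "X = fObj F X'" using obj by blast
    then show "fObj G X \<in> Obj C" by (simp add: GF)
    have "fArr G (fArr F (Ident C X')) = Ident C X'"
      using HomD[OF F.C.Ident_in[OF X'(1)]] by (simp add: GFa)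
    then show "fArr G (Ident D X) = Ident C (fObj G X)"
      using X' by (simp add: GF F.fArr_Ident)
  next
    fix f X Y assume "f \<in> Hom D X Y"
    then show "fArr G f \<in> Hom C (fObj G X) (fObj G Y)" using arr by blast
  next
    fix f X Y g Z assume f: "f \<in> Hom D X Y" and g: "g \<in> Hom D Y Z"
    obtain f' g' where f': "f' \<in> Hom C (fObj G X) (fObj G Y)" "fArr G f = f'" "fArr F f' = f"
      and g': "g' \<in> Hom C (fObj G Y) (fObj G Z)" "fArr G g = g'" "fArr F g' = g"
      using arr[OF f] arr[OF g] by blast
    have "fArr G (fArr F (Cmp C g' f')) = Cmp C g' f'"
      using HomD[OF F.C.Cmp_in[OF f'(1) g'(1)]] by (simp add: GFa)
    then show "fArr G (Cmp D g f) = Cmp C (fArr G g) (fArr G f)"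
      using f'(2,3) g'(2,3) by (simp add: F.fArr_Cmp[OF f'(1) g'(1)])
  qed
  moreover have "fObj F (fObj G Y) = Y" if "Y \<in> Obj D" for Y using obj[OF that] GF by auto
  moreover have "fArr F (fArr G g) = g" if "g \<in> Arr D" for g
    using arr[of g "Dom D g" "Cod D g"] that by (auto simp: Hom_def)
  ultimately have "inverse_functors C D F G"
    by (simp add: inverse_functors_def GF GFa F.cat_functor_axioms)
  then show ?thesis by (auto simp: cat_isomorphism_def)
qed

lemma isomorphism_imp_surj:
  assumes "cat_isomorphism C D F"
  shows "fObj F ` Obj C = Obj D" "fArr F ` Arr C = Arr D"
proof -
  obtain G where G: "inverse_functors C D F G" using assms by (auto simp: cat_isomorphism_def)
  interpret F: cat_functor C D F using G by (simp add: inverse_functors_def)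
  interpret G: cat_functor D C G using G by (simp add: inverse_functors_def)
  have FA: "fArr F f \<in> Arr D" if "f \<in> Arr C" for f
    using F.fArr_in[of f "Dom C f" "Cod C f"] that by (simp add: Hom_def)
  have GA: "fArr G g \<in> Arr C" if "g \<in> Arr D" for g
    using G.fArr_in[of g "Dom D g" "Cod D g"] that by (simp add: Hom_def)
  show "fObj F ` Obj C = Obj D"
  proof
    show "Obj D \<subseteq> fObj F ` Obj C"
    proof
      fix Y assume Y: "Y \<in> Obj D"
      then have "fObj F (fObj G Y) = Y" using G by (simp add: inverse_functors_def)
      then show "Y \<in> fObj F ` Obj C" using G.fObj_in[OF Y] by (metis imageI)
    qed
  qed (use F.fObj_in in blast)
  show "fArr F ` Arr C = Arr D"
  proof
    show "Arr D \<subseteq> fArr F ` Arr C"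
    proof
      fix g assume g: "g \<in> Arr D"
      then have "fArr F (fArr G g) = g" using G by (simp add: inverse_functors_def)
      then show "g \<in> fArr F ` Arr C" using GA[OF g] by (metis imageI)
    qed
  qed (use FA in blast)
qed

text \<open>An equality \<open>d = c\<^sup>F\<close> is transported along an inverse \<open>G\<close> of \<open>F\<close> to \<open>d\<^sup>G = c\<close>, because
  every object and arrow of \<open>D\<close> is the image under \<open>F\<close> of its image under \<open>G\<close>.\<close>

lemma gcat_eq_gpullback_inverse:
  assumes inv: "inverse_functors C D F G" and eq: "gcat_eq C d (gpullback c F)"
  shows "gcat_eq D (gpullback d G) c"
proof -
  interpret G: cat_functor D C G using inv by (simp add: inverse_functors_def)
  have FG: "fObj F (fObj G Y) = Y" if "Y \<in> Obj D" for Y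
    using inv that by (simp add: inverse_functors_def)
  have FGa: "fArr F (fArr G g) = g" if "g \<in> Hom D X Y" for g X Y
    using inv HomD[OF that] by (simp add: inverse_functors_def)
  have o: "gObj d X = gObj c (fObj F X)" if "X \<in> Obj C" for X
    using eq that by (simp add: gcat_eq_def gpullback_def)
  have i: "gId d X A = gId c (fObj F X) A" if "X \<in> Obj C" "A \<in> gObj d X" for X A
    using eq that by (simp add: gcat_eq_def gpullback_def)
  have h: "gHom d f A B = gHom c (fArr F f) A B"
    if "f \<in> Hom C X Y" "A \<in> gObj d X" "B \<in> gObj d Y" for f X Y A B
    using eq that unfolding gcat_eq_def gpullback_def by simp
  have m: "gComp d g f A A' A'' y x = gComp c (fArr F g) (fArr F f) A A' A'' y x"
    if "f \<in> Hom C X Y" "g \<in> Hom C Y Z" "A \<in> gObj d X" "A' \<in> gObj d Y" "A'' \<in> gObj d Z"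
      "y \<in> carrier (gHom d g A' A'')" "x \<in> carrier (gHom d f A A')" for f g X Y Z A A' A'' x y
    using eq that unfolding gcat_eq_def gpullback_def by simp
  show ?thesis
    unfolding gcat_eq_def gpullback_def gcat.simps
  proof (intro conjI ballI allI impI)
    fix X assume "X \<in> Obj D"
    then show "gObj d (fObj G X) = gObj c X" using o G.fObj_in FG by simp
  next
    fix X A assume "X \<in> Obj D" "A \<in> gObj d (fObj G X)"
    then show "gId d (fObj G X) A = gId c X A" using i G.fObj_in FG by simp
  next
    fix X Y f A B
    assume "f \<in> Hom D X Y" "A \<in> gObj d (fObj G X)" "B \<in> gObj d (fObj G Y)"
    then show "gHom d (fArr G f) A B = gHom c f A B" using h G.fArr_in FGa by metis
  next
    fix X Y Z f g A A' A'' y x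
    assume "f \<in> Hom D X Y" "g \<in> Hom D Y Z"
      "A \<in> gObj d (fObj G X)" "A' \<in> gObj d (fObj G Y)" "A'' \<in> gObj d (fObj G Z)"
      "y \<in> carrier (gHom d (fArr G g) A' A'')" "x \<in> carrier (gHom d (fArr G f) A A')"
    then show "gComp d (fArr G g) (fArr G f) A A' A'' y x = gComp c g f A A' A'' y x"
      using m[OF G.fArr_in G.fArr_in, of f X Y g Z A A' A'' y x] FGa by metis
  qed
qed


section \<open>Sources and targets of a thin ideal\<close>

lemma cat_ideal_Cmp:
  assumes "cat_ideal W S"
  shows "s \<in> S \<Longrightarrow> s \<in> Hom W X Y \<Longrightarrow> w \<in> Hom W Y Z \<Longrightarrow> Cmp W w s \<in> S"
    and "s \<in> S \<Longrightarrow> s \<in> Hom W X Y \<Longrightarrow> w \<in> Hom W Z X \<Longrightarrow> Cmp W s w \<in> S"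
  using assms unfolding cat_ideal_def by blast+

context category
begin

lemma path_last_in_ideal_imp_arrow:
  assumes "cat_ideal C S" "is_path C X fs Y" "fs \<noteq> []" "last fs \<in> S"
  shows "\<exists>s. s \<in> S \<inter> Hom C X Y"
  using assms(2-4)
proof (induction fs arbitrary: X)
  case (Cons f fs)
  show ?case
  proof (cases "fs = []")
    case True
    with Cons.prems show ?thesis by (auto simp: Hom_def)
  next
    case False
    with Cons obtain s where s: "s \<in> S" "s \<in> Hom C (Cod C f) Y" by auto
    moreover have f: "f \<in> Hom C X (Cod C f)" using Cons.prems by (simp add: Hom_def)
    ultimately show ?thesis using Cmp_in[OF f s(2)] cat_ideal_Cmp(2)[OF assms(1) s f] by blast
  qed
qed simp

text \<open>For a path whose first map is in the ideal, the composite so far has to be carried along as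
  an arrow of the ideal, so the induction is over the rest of the path.\<close>

lemma ideal_arrow_extend_along_path:
  assumes "cat_ideal C S" "is_path C Y fs Z" "s \<in> S \<inter> Hom C X Y"
  shows "\<exists>t. t \<in> S \<inter> Hom C X Z"
  using assms(2,3)
proof (induction fs arbitrary: Y s)
  case (Cons f fs)
  have f: "f \<in> Hom C Y (Cod C f)" using Cons.prems by (simp add: Hom_def)
  have s: "s \<in> S" "s \<in> Hom C X Y" using Cons.prems by auto
  have "Cmp C f s \<in> S \<inter> Hom C X (Cod C f)"
    using Cmp_in[OF s(2) f] cat_ideal_Cmp(1)[OF assms(1) s f] by blast
  then show ?case using Cons.IH Cons.prems(1) by auto
qed auto

lemma path_hd_in_ideal_imp_arrow:
  assumes "cat_ideal C S" "is_path C X fs Y" "fs \<noteq> []" "hd fs \<in> S"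
  shows "\<exists>s. s \<in> S \<inter> Hom C X Y"
  using assms ideal_arrow_extend_along_path[OF assms(1), of _ "tl fs" Y "hd fs" X]
  by (cases fs) (auto simp: Hom_def)

lemma Obj_source_cat:
  assumes "cat_ideal C S"
  shows "X \<in> Obj (source_cat C S) \<longleftrightarrow> (\<exists>Y. S \<inter> Hom C X Y \<noteq> {})"
proof
  assume "X \<in> Obj (source_cat C S)"
  then show "\<exists>Y. S \<inter> Hom C X Y \<noteq> {}"
    using path_last_in_ideal_imp_arrow[OF assms] by (fastforce simp: source_cat_def)
next
  assume "\<exists>Y. S \<inter> Hom C X Y \<noteq> {}"
  then obtain Y s where s: "s \<in> S" "s \<in> Hom C X Y" by blast
  then have "is_path C X [s] Y" using Hom_Obj HomD by fastforce
  then show "X \<in> Obj (source_cat C S)"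
    using s Hom_Obj[OF s(2)] unfolding source_cat_def
    by (auto intro!: exI[of _ "[s]"])
qed

lemma Obj_target_cat:
  assumes "cat_ideal C S"
  shows "Y \<in> Obj (target_cat C S) \<longleftrightarrow> (\<exists>X. S \<inter> Hom C X Y \<noteq> {})"
proof
  assume "Y \<in> Obj (target_cat C S)"
  then show "\<exists>X. S \<inter> Hom C X Y \<noteq> {}"
    using path_hd_in_ideal_imp_arrow[OF assms] by (fastforce simp: target_cat_def)
next
  assume "\<exists>X. S \<inter> Hom C X Y \<noteq> {}"
  then obtain X s where s: "s \<in> S" "s \<in> Hom C X Y" by blast
  then have "is_path C X [s] Y" using Hom_Obj HomD by fastforce
  then show "Y \<in> Obj (target_cat C S)"
    using s Hom_Obj[OF s(2)] unfolding target_cat_def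
    by (auto intro!: exI[of _ "[s]"])
qed

lemma thin_no_consecutive:
  assumes "thin C S" "s \<in> S" "s \<in> Hom C X Y" "t \<in> Hom C Y Z"
  shows "t \<notin> S"
  \<comment> \<open>Thinness speaks of an arrow on either side of \<open>s\<close>; the left one is an identity here.\<close>
  using assms Ident_in Hom_Obj[OF assms(3)] unfolding thin_def by blast

lemma no_arrow_back:
  assumes "cat_ideal C S" "thin C S" "Y \<in> Obj (target_cat C S)" "X \<in> Obj (source_cat C S)"
  shows "Hom C Y X = {}"
proof (rule equals0I)
  fix f assume f: "f \<in> Hom C Y X"
  obtain Z s where s: "s \<in> S" "s \<in> Hom C Z Y" using assms Obj_target_cat by blast
  obtain T t where t: "t \<in> S" "t \<in> Hom C X T" using assms Obj_source_cat by blast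
  show False
    using thin_no_consecutive[OF assms(2) cat_ideal_Cmp(1)[OF assms(1) s f] Cmp_in[OF s(2) f] t(2)]
      t(1) by blast
qed

end


section \<open>The functor from the arrow category to the ambient category\<close>

definition arrow_forget :: "('o + 'o, ('o, 'm, 'o, 'm, 'm) arrow, 'o, 'm) ftr" where
  "arrow_forget = \<lparr>fObj = case_sum (\<lambda>X. X) (\<lambda>Y. Y),
     fArr = case_arrow (\<lambda>v. v) (\<lambda>u. u) (\<lambda>X Y s. s)\<rparr>"

lemma arrow_forget_sel [simp]:
  "fObj arrow_forget (Inl X) = X" "fObj arrow_forget (Inr Y) = Y"
  "fArr arrow_forget (ArrV v) = v" "fArr arrow_forget (ArrU u) = u"
  "fArr arrow_forget (ArrS X Y s) = s"
  by (simp_all add: arrow_forget_def)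

lemma sObj_ideal_bifunctor [simp]: "sObj (ideal_bifunctor W S) (X, Y) = S \<inter> Hom W X Y"
  by (simp add: ideal_bifunctor_def)

text \<open>On arrows of \<open>\<W>\<close> the actions of \<open>\<U>\<close> and \<open>\<V>\<close> are plain composition, although each is defined
  through the bifunctor with an identity in the other argument.\<close>

lemma (in category) act_ideal_bifunctor:
  assumes "s \<in> Hom C X Y"
  shows "u \<in> Hom C Y Z \<Longrightarrow> lact (full_subcat C Q) (ideal_bifunctor C S) X u s = Cmp C u s"
    and "v \<in> Hom C T X \<Longrightarrow> ract (full_subcat C P) (ideal_bifunctor C S) Y s v = Cmp C s v"
  using Cmp_Ident_right[OF assms] Cmp_Ident_left[OF Cmp_in[OF _ assms]]
  by (auto simp: lact_def ract_def ideal_bifunctor_def)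

text \<open>Below, the full subcategories on \<open>P\<close> and \<open>Q\<close> are in the positions of \<open>\<U>\<close> and \<open>\<V>\<close>, so the arrows
  taken from the ideal run from \<open>Q\<close> to \<open>P\<close>.\<close>

context
  fixes W :: "('o, 'm) cat" and S :: "'m set" and P Q :: "'o set"
  assumes W: "category W" and S: "cat_ideal W S"
begin

interpretation W: category W by (rule W)

abbreviation "ideal_arrow_cat \<equiv> arrow_cat (full_subcat W P) (full_subcat W Q) (ideal_bifunctor W S)"

interpretation A: category ideal_arrow_cat
  by (rule bifunctor.category_arrow_cat[OF bifunctor_ideal_bifunctor[OF W S]])

lemma cat_functor_arrow_forget: "cat_functor ideal_arrow_cat W arrow_forget"
proof
  fix X assume "X \<in> Obj ideal_arrow_cat"
  then show "fObj arrow_forget X \<in> Obj W"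
    and "fArr arrow_forget (Ident ideal_arrow_cat X) = Ident W (fObj arrow_forget X)" by auto
next
  fix f X Y assume "f \<in> Hom ideal_arrow_cat X Y"
  then show "fArr arrow_forget f \<in> Hom W (fObj arrow_forget X) (fObj arrow_forget Y)"
    by (cases X; cases Y) (auto simp: Hom_full_subcat)
next
  fix f X Y g Z assume "f \<in> Hom ideal_arrow_cat X Y" "g \<in> Hom ideal_arrow_cat Y Z"
  then show "fArr arrow_forget (Cmp ideal_arrow_cat g f)
      = Cmp W (fArr arrow_forget g) (fArr arrow_forget f)"
    by (cases X; cases Y; cases Z) (auto simp: Hom_full_subcat W.act_ideal_bifunctor)
qed

text \<open>With no common object, the end points of an arrow of \<open>W\<close> tell whether it comes from \<open>ArrV\<close>, from
  \<open>ArrU\<close> or from \<open>ArrS\<close>; in the last case they also recover the recorded end points.\<close>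

lemma injection_arrow_forget:
  assumes "P \<inter> Q \<inter> Obj W = {}"
  shows "injection ideal_arrow_cat W arrow_forget"
proof -
  have *: "\<not> (X \<in> P \<and> X \<in> Q)" if "X \<in> Obj W" for X using assms that by blast
  have "inj_on (fObj arrow_forget) (Obj ideal_arrow_cat)"
    using * by (auto simp: inj_on_def)
  moreover have "inj_on (fArr arrow_forget) (Arr ideal_arrow_cat)"
  proof (rule inj_onI)
    fix f g assume f: "f \<in> Arr ideal_arrow_cat" and g: "g \<in> Arr ideal_arrow_cat"
      and eq: "fArr arrow_forget f = fArr arrow_forget g"
    have O: "Dom W (fArr arrow_forget f) \<in> Obj W" "Cod W (fArr arrow_forget f) \<in> Obj W"
      using f W.Dom_in W.Cod_in by (auto simp: arrow_cat_def full_subcat_def Hom_def)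
    show "f = g"
      using f g eq *[OF O(1)] *[OF O(2)]
      by (cases f; cases g) (auto simp: arrow_cat_def full_subcat_def Hom_def)
  qed
  ultimately show ?thesis by (simp add: injection_def cat_functor_arrow_forget)
qed

text \<open>The hypothesis on arrows from \<open>P\<close> to \<open>Q\<close> makes covering the objects enough to cover every arrow
  that does not run from \<open>Q\<close> to \<open>P\<close>.\<close>

lemma isomorphism_arrow_forget_iff:
  assumes no_back: "\<And>X Y. X \<in> Q \<Longrightarrow> Y \<in> P \<Longrightarrow> Hom W Y X = {}"
  shows "cat_isomorphism ideal_arrow_cat W arrow_forget \<longleftrightarrow>
    Obj W \<subseteq> Q \<union> P \<and> (\<forall>X\<in>Q. \<forall>Y\<in>P. Hom W X Y \<subseteq> S)"
    (is "?iso \<longleftrightarrow> ?cov")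
proof -
  have disj: "P \<inter> Q \<inter> Obj W = {}" using no_back W.Ident_in by fastforce
  show ?thesis
  proof
    assume iso: ?iso
    have "Obj W \<subseteq> Q \<union> P"
      using isomorphism_imp_surj(1)[OF iso] by auto
    moreover have "f \<in> S" if XY: "X \<in> Q" "Y \<in> P" and f: "f \<in> Hom W X Y" for X Y f
    proof -
      obtain g where g: "g \<in> Arr ideal_arrow_cat" "f = fArr arrow_forget g"
        using isomorphism_imp_surj(2)[OF iso] HomD[OF f] by blast
      \<comment> \<open>A preimage of the form \<open>ArrV v\<close> or \<open>ArrU u\<close> would put an end point of \<open>f\<close>
        into both \<open>P\<close> and \<open>Q\<close>.\<close>
      show ?thesis
        using g XY f disj W.Hom_Obj[OF f] by (auto simp: arrow_cat_def full_subcat_def Hom_def)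
    qed
    ultimately show ?cov by blast
  next
    assume *: ?cov
    show ?iso
    proof (rule injection_surj_imp_isomorphism[OF injection_arrow_forget[OF disj]])
      show "Obj W \<subseteq> fObj arrow_forget ` Obj ideal_arrow_cat"
      proof
        fix X assume "X \<in> Obj W"
        with * have "X = fObj arrow_forget (Inl X) \<and> Inl X \<in> Obj ideal_arrow_cat
            \<or> X = fObj arrow_forget (Inr X) \<and> Inr X \<in> Obj ideal_arrow_cat" by auto
        then show "X \<in> fObj arrow_forget ` Obj ideal_arrow_cat" by blast
      qed
      show "Arr W \<subseteq> fArr arrow_forget ` Arr ideal_arrow_cat"
      proof
        fix f assume f: "f \<in> Arr W"
        let ?X = "Dom W f" and ?Y = "Cod W f"
        have hom: "f \<in> Hom W ?X ?Y" and O: "?X \<in> Obj W" "?Y \<in> Obj W"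
          using f W.Dom_in W.Cod_in by (auto simp: Hom_def)
        consider "?X \<in> Q" "?Y \<in> Q" | "?X \<in> P" "?Y \<in> P" | "?X \<in> Q" "?Y \<in> P"
          using * O no_back hom by blast
        moreover have "f \<in> S" if "?X \<in> Q" "?Y \<in> P" using * that hom by blast
        ultimately have "ArrV f \<in> Arr ideal_arrow_cat \<or> ArrU f \<in> Arr ideal_arrow_cat
            \<or> ArrS ?X ?Y f \<in> Arr ideal_arrow_cat"
          using f hom O by cases (auto simp: arrow_cat_def full_subcat_def)
        then show "f \<in> fArr arrow_forget ` Arr ideal_arrow_cat"
          using image_eqI[of f "fArr arrow_forget"] arrow_forget_sel by metis
      qed
    qed
  qed
qed

text \<open>Both sides unfold to the data of \<open>c\<close>; the case split on end points selects which clause of the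
  arrow category applies.\<close>

lemma gcat_eq_arrow_forget:
  "gcat_eq ideal_arrow_cat
     (arrow_gcat (gpullback c inclusion) (gpullback c inclusion) (identity_bimodule c))
     (gpullback c arrow_forget)"
  unfolding gcat_eq_def
proof (intro conjI ballI allI impI, goal_cases)
  case (1 X)
  then show ?case by (cases X) (auto simp: gpullback_def inclusion_def)
next
  case (2 X Y f C C')
  then show ?case
    by (cases X; cases Y) (auto simp: gpullback_def inclusion_def identity_bimodule_def)
next
  case (3 X Y Z f g C C' C'' y x)
  then show ?case
    by (cases X; cases Y; cases Z)
      (auto simp: gpullback_def inclusion_def identity_bimodule_def)
next
  case (4 X C)
  then show ?case by (cases X) (auto simp: gpullback_def inclusion_def)
qed

end


section \<open>Decomposition along a thin ideal\<close>

theorem proposition5p8: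
  fixes k :: "'k ring" and W :: "('o, 'm) cat" and c :: "('o, 'm, 'c, 'k, 'x) gcat"
    and \<S> :: "'m set"
  assumes "graded_category k W c" and "cat_ideal W \<S>" and "thin W \<S>"
  defines "V \<equiv> source_cat W \<S>" and "U \<equiv> target_cat W \<S>"
  defines "a \<equiv> gpullback c (inclusion :: ('o, 'm, 'o, 'm) ftr)"
    and "b \<equiv> gpullback c (inclusion :: ('o, 'm, 'o, 'm) ftr)"
    and "S \<equiv> ideal_bifunctor W \<S>" and "M \<equiv> identity_bimodule c"
  shows "graded_bimodule k U V a b S M
    \<and> (\<forall>Y\<in>Obj U. \<forall>X\<in>Obj V. Hom W Y X = {})
    \<and> Obj U \<inter> Obj V = {} \<and> Arr U \<inter> Arr V = {}
    \<and> (\<exists>\<phi>. injection (arrow_cat U V S) W \<phi>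
         \<and> (\<forall>X\<in>Obj V. fObj \<phi> (Inl X) = X) \<and> (\<forall>Y\<in>Obj U. fObj \<phi> (Inr Y) = Y)
         \<and> (\<forall>v\<in>Arr V. fArr \<phi> (ArrV v) = v) \<and> (\<forall>u\<in>Arr U. fArr \<phi> (ArrU u) = u)
         \<and> (\<forall>X\<in>Obj V. \<forall>Y\<in>Obj U. \<forall>s\<in>sObj S (X, Y). fArr \<phi> (ArrS X Y s) = s)
         \<and> gcat_eq (arrow_cat U V S) (arrow_gcat a b M) (gpullback c \<phi>)
         \<and> (cat_isomorphism (arrow_cat U V S) W \<phi> \<longleftrightarrow>
              Obj W = Obj V \<union> Obj U
              \<and> (\<forall>X\<in>Obj V. \<forall>Y\<in>Obj U. \<S> \<inter> Hom W X Y = Hom W X Y))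
         \<and> (cat_isomorphism (arrow_cat U V S) W \<phi> \<longrightarrow>
              (\<exists>\<psi>. inverse_functors (arrow_cat U V S) W \<phi> \<psi>
                 \<and> gcat_eq W (gpullback (arrow_gcat a b M) \<psi>) c)))"
proof -
  interpret c: graded_category k W c by fact
  have cat: "category W" by unfold_locales
  obtain P where U: "U = full_subcat W P" unfolding U_def target_cat_def by blast
  obtain Q where V: "V = full_subcat W Q" unfolding V_def source_cat_def by blast
  have no_back: "Hom W Y X = {}" if "Y \<in> Obj U" "X \<in> Obj V" for X Y
    using c.W.no_arrow_back[OF assms(2,3)] that by (simp add: U_def V_def)
  have disj: "Obj U \<inter> Obj V = {}"
    using no_back c.W.Ident_in by (fastforce simp: U)
  have disjA: "Arr U \<inter> Arr V = {}"
    using disj c.W.Dom_in by (auto simp: U V full_subcat_def)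
  have no_backPQ: "Hom W Y X = {}" if "X \<in> Q" "Y \<in> P" for X Y
    using no_back[of Y X] that c.W.Hom_Obj[of _ Y X] by (auto simp: U V)
  have disjPQ: "P \<inter> Q \<inter> Obj W = {}" using disj by (auto simp: U V)
  have cover: "Obj W = Obj V \<union> Obj U \<longleftrightarrow> Obj W \<subseteq> Q \<union> P" by (auto simp: U V)
  have full: "(\<forall>X\<in>Obj V. \<forall>Y\<in>Obj U. \<S> \<inter> Hom W X Y = Hom W X Y)
      \<longleftrightarrow> (\<forall>X\<in>Q. \<forall>Y\<in>P. Hom W X Y \<subseteq> \<S>)"
    using c.W.Hom_Obj by (fastforce simp: U V)
  have eq: "gcat_eq (arrow_cat U V S) (arrow_gcat a b M) (gpullback c arrow_forget)"
    unfolding U V S_def a_def b_def M_def by (rule gcat_eq_arrow_forget[OF cat assms(2)])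
  have iso: "cat_isomorphism (arrow_cat U V S) W arrow_forget \<longleftrightarrow>
      Obj W = Obj V \<union> Obj U \<and> (\<forall>X\<in>Obj V. \<forall>Y\<in>Obj U. \<S> \<inter> Hom W X Y = Hom W X Y)"
    unfolding cover full unfolding U V S_def
    by (rule isomorphism_arrow_forget_iff[OF cat assms(2) no_backPQ])
  have inv: "\<exists>\<psi>. inverse_functors (arrow_cat U V S) W arrow_forget \<psi>
      \<and> gcat_eq W (gpullback (arrow_gcat a b M) \<psi>) c"
    if "cat_isomorphism (arrow_cat U V S) W arrow_forget"
    using that gcat_eq_gpullback_inverse[OF _ eq] unfolding cat_isomorphism_def by blast
  have inj: "injection (arrow_cat U V S) W arrow_forget"
    unfolding U V S_def by (rule injection_arrow_forget[OF cat assms(2) disjPQ])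
  have bim: "graded_bimodule k U V a b S M"
    unfolding U V S_def a_def b_def M_def
    by (rule graded_bimodule_identity_bimodule[OF assms(1,2)])
  show ?thesis
    using bim no_back disj disjA inj eq iso inv
    by (intro conjI exI[of _ arrow_forget]) simp_all
qed

end
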